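(* Let $\mathcal A$ be a finite alphabet with $r$ letters, equipped with a pair of strict total orders $(<_A,<_D)$. Let $L$ be a language on $\mathcal A$ satisfying the order condition for $(<_A,<_D)$. Let $w\in L$ and let $U_1,\dots,U_s$ ($1\le s\le r$) be $s$ distinct suffix return words (resp. prefix return words) of $w$ in $L$. Let $\mathcal A'=\{a_1,\dots,a_s\}$ and let $\phi:\mathcal A'^*\to\mathcal A^*$ be the morphism with $\phi a_i=U_i$. Define on $\mathcal A'$ the derived orders with respect to $w$: (1) $a_i<_{Aw}a_j$ iff, comparing the words $w\phi a_i$ and $w\phi a_j$ from right to left (i.e. aligned at their last letters), at the first position from the right where they differ the letter of $w\phi a_i$ is $<_A$-smaller than that of $w\phi a_j$ (antilexicographic order induced by $<_A$); (2) $a_i<_{Dw}a_j$ iff, comparing $\phi a_i w$ and $\phi a_j w$ from left to right, at the first position where they differ the letter of $\phi a_i w$ is $<_D$-smaller than that of $\phi a_j w$ (lexicographic order induced by $<_D$). Then these are well-defined strict total orders on $\mathcal A'$, and for every word $v$ on $\mathcal A'$, the word $\phi v$ clusters for $(<_A,<_D)$ on $\mathcal A$ if and only if $v$ clusters for $(<_{Aw},<_{Dw})$ on $\mathcal A'$.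
   Context: A language over a finite alphabet is a set $L$ of finite words containing the empty word, closed under taking factors, and extendable (for every $v\in L$ there are letters $a,b$ with $av,vb\in L$). A word $v\in L$ is bispecial if there are at least two letters $x$ with $xv\in L$ and at least two letters $y$ with $vy\in L$. A bispecial word $v$ satisfies the order condition for a pair of strict total orders $(<_A,<_D)$ if whenever $xvy, x'vy'\in L$ with letters $x\neq x'$, $y\ne y'$, then $x<_Ax'$ iff $y<_Dy'$; $L$ satisfies the order condition if all its bispecial words (including the empty word) do. A suffix return word of $w$ in $L$ is a word $v\in L$ such that $wv\in L$ has exactly two occurrences of $w$, one as a prefix and one as a suffix; a prefix return word of $w$ is a word $v\in L$ such that $vw\in L$ has exactly two occurrences of $w$, one as a prefix and one as a suffix. For a word $u=u_1\cdots u_n$, its cyclic conjugates are the $n$ words $u_i\cdots u_nu_1\cdots u_{i-1}$, $1\le i\le n$ (counted with multiplicity). The Burrows–Wheeler transform $B(u)$ is obtained by listing these $n$ conjugates in non-decreasing lexicographic order with respect to $<_D$ and concatenating their last letters. The word $u$ clusters for $(<_A,<_D)$ if $B(u)=c_1^{n_{c_1}}\cdots c_r^{n_{c_r}}$, where $c_1<_A\cdots<_Ac_r$ are the letters of the alphabet and $n_c$ is the number of occurrences of $c$ in $u$. *)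

theory Defs
  imports Main "HOL-Library.Sublist" "HOL-Library.Multiset"
begin

definition language :: "'a set \<Rightarrow> 'a list set \<Rightarrow> bool" where
  "language A L \<longleftrightarrow>
     L \<subseteq> lists A \<and> [] \<in> L \<and>
     (\<forall>u\<in>L. \<forall>v. sublist v u \<longrightarrow> v \<in> L) \<and>
     (\<forall>v\<in>L. \<exists>a\<in>A. \<exists>b\<in>A. a # v \<in> L \<and> v @ [b] \<in> L)"

definition bispecial :: "'a list set \<Rightarrow> 'a list \<Rightarrow> bool" where
  "bispecial L v \<longleftrightarrow>
     v \<in> L \<and>
     (\<exists>x x'. x \<noteq> x' \<and> x # v \<in> L \<and> x' # v \<in> L) \<and>
     (\<exists>y y'. y \<noteq> y' \<and> v @ [y] \<in> L \<and> v @ [y'] \<in> L)"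

definition word_order_condition ::
    "('a \<times> 'a) set \<Rightarrow> ('a \<times> 'a) set \<Rightarrow> 'a list set \<Rightarrow> 'a list \<Rightarrow> bool" where
  "word_order_condition rA rD L v \<longleftrightarrow>
     (\<forall>x x' y y'. x # v @ [y] \<in> L \<and> x' # v @ [y'] \<in> L \<and> x \<noteq> x' \<and> y \<noteq> y' \<longrightarrow>
        ((x, x') \<in> rA \<longleftrightarrow> (y, y') \<in> rD))"

definition order_condition ::
    "('a \<times> 'a) set \<Rightarrow> ('a \<times> 'a) set \<Rightarrow> 'a list set \<Rightarrow> bool" where
  "order_condition rA rD L \<longleftrightarrow> (\<forall>v. bispecial L v \<longrightarrow> word_order_condition rA rD L v)"

definition occurrences :: "'a list \<Rightarrow> 'a list \<Rightarrow> nat set" where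
  "occurrences w u = {i. i + length w \<le> length u \<and> take (length w) (drop i u) = w}"

definition suffix_return_word :: "'a list set \<Rightarrow> 'a list \<Rightarrow> 'a list \<Rightarrow> bool" where
  "suffix_return_word L w v \<longleftrightarrow>
     v \<in> L \<and> w @ v \<in> L \<and> card (occurrences w (w @ v)) = 2 \<and>
     prefix w (w @ v) \<and> suffix w (w @ v)"

definition prefix_return_word :: "'a list set \<Rightarrow> 'a list \<Rightarrow> 'a list \<Rightarrow> bool" where
  "prefix_return_word L w v \<longleftrightarrow>
     v \<in> L \<and> v @ w \<in> L \<and> card (occurrences w (v @ w)) = 2 \<and>
     prefix w (v @ w) \<and> suffix w (v @ w)"

definition conjugates :: "'a list \<Rightarrow> 'a list list" where
  "conjugates u = map (\<lambda>i. rotate i u) [0..<length u]"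

definition sorted_conjugates :: "('a \<times> 'a) set \<Rightarrow> 'a list \<Rightarrow> 'a list list" where
  "sorted_conjugates r u =
     (THE cs. mset cs = mset (conjugates u) \<and>
              sorted_wrt (\<lambda>x y. x = y \<or> (x, y) \<in> lexord r) cs)"

definition bwt :: "('a \<times> 'a) set \<Rightarrow> 'a list \<Rightarrow> 'a list" where
  "bwt r u = map last (sorted_conjugates r u)"

definition clusters :: "'a set \<Rightarrow> ('a \<times> 'a) set \<Rightarrow> ('a \<times> 'a) set \<Rightarrow> 'a list \<Rightarrow> bool" where
  "clusters A rA rD u \<longleftrightarrow>
     (\<exists>cs. set cs = A \<and> distinct cs \<and> sorted_wrt (\<lambda>x y. (x, y) \<in> rA) cs \<and>
           bwt rD u = concat (map (\<lambda>c. replicate (count_list u c) c) cs))"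

text \<open>
  Unlike \<^const>\<open>lexord\<close>, this relates no word to a proper extension of itself: the comparison is
  decided only by a position at which both words have a letter. That such a position exists is
  part of the claim that the derived orders are well defined.
\<close>

definition first_diff_less :: "('a \<times> 'a) set \<Rightarrow> 'a list \<Rightarrow> 'a list \<Rightarrow> bool" where
  "first_diff_less r u v \<longleftrightarrow>
     (\<exists>k. k < length u \<and> k < length v \<and> take k u = take k v \<and>
          u ! k \<noteq> v ! k \<and> (u ! k, v ! k) \<in> r)"

definition derived_A ::
    "('a \<times> 'a) set \<Rightarrow> 'a list \<Rightarrow> 'b set \<Rightarrow> ('b \<Rightarrow> 'a list) \<Rightarrow> ('b \<times> 'b) set" where
  "derived_A rA w A' \<phi> =
     {(a, b). a \<in> A' \<and> b \<in> A' \<and> first_diff_less rA (rev (w @ \<phi> a)) (rev (w @ \<phi> b))}"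

definition derived_D ::
    "('a \<times> 'a) set \<Rightarrow> 'a list \<Rightarrow> 'b set \<Rightarrow> ('b \<Rightarrow> 'a list) \<Rightarrow> ('b \<times> 'b) set" where
  "derived_D rD w A' \<phi> =
     {(a, b). a \<in> A' \<and> b \<in> A' \<and> first_diff_less rD (\<phi> a @ w) (\<phi> b @ w)}"

lemma ex_sorted_wrt:
  assumes tot: "\<And>x y. x \<in> S \<Longrightarrow> y \<in> S \<Longrightarrow> R x y \<or> R y x"
    and tr: "\<And>x y z. R x y \<Longrightarrow> R y z \<Longrightarrow> R x z"
    and "set xs \<subseteq> S"
  shows "\<exists>cs. mset cs = mset xs \<and> sorted_wrt R cs"
  using assms(3)
proof (induction xs)
  case (Cons x xs)
  then obtain cs where cs: "mset cs = mset xs" "sorted_wrt R cs" by auto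
  have S: "set cs \<subseteq> S" "x \<in> S"
    using Cons.prems cs(1) by (auto dest: mset_eq_setD)
  let ?l = "filter (\<lambda>y. R y x) cs" and ?r = "filter (\<lambda>y. \<not> R y x) cs"
  have "mset (?l @ x # ?r) = mset (x # xs)"
    using cs(1) multiset_partition[of "mset cs" "\<lambda>y. R y x"] by simp
  moreover have "sorted_wrt R (?l @ x # ?r)"
    using cs(2) S by (auto simp: sorted_wrt_append sorted_wrt_filter intro: tr dest: tot)
  ultimately show ?case by blast
qed simp

lemma sorted_wrt_unique:
  assumes anti: "\<And>x y. R x y \<Longrightarrow> R y x \<Longrightarrow> x = y"
    and "sorted_wrt R xs" "sorted_wrt R ys" "mset xs = mset ys"
  shows "xs = ys"
  using assms(2-)
proof (induction xs arbitrary: ys)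
  case (Cons x xs)
  then obtain y ys' where ys: "ys = y # ys'" by (cases ys) auto
  have "set (x # xs) = set (y # ys')"
    using Cons.prems(3) ys by (metis mset_eq_setD)
  hence "x = y \<or> (x \<in> set ys' \<and> y \<in> set xs)" by auto
  hence "x = y" using Cons.prems(1,2) ys anti by auto
  thus ?case using Cons ys by auto
qed simp

lemma ex1_sorted_conjugates:
  assumes r: "strict_linear_order_on A r" and u: "u \<in> lists A"
  shows "\<exists>!cs. mset cs = mset (conjugates u) \<and>
               sorted_wrt (\<lambda>x y. x = y \<or> (x, y) \<in> lexord r) cs"
proof -
  let ?R = "\<lambda>x y. x = y \<or> (x, y) \<in> lexord r"
  have tr: "trans (lexord r)" and irr: "irrefl (lexord r)"
    using r by (auto simp: strict_linear_order_on_def irrefl_def intro: lexord_trans transI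
        dest: lexord_irreflexive[rotated])
  have tot: "?R x y \<or> ?R y x" if "x \<in> lists A" "y \<in> lists A" for x y
    using that
  proof (induction x arbitrary: y)
    case Nil
    then show ?case by (cases y) auto
  next
    case (Cons a x)
    then show ?case
      using r by (cases y) (auto simp: strict_linear_order_on_def total_on_def)
  qed
  have S: "set (conjugates u) \<subseteq> lists A"
    using u by (auto simp: conjugates_def in_lists_conv_set)
  have "\<exists>cs. mset cs = mset (conjugates u) \<and> sorted_wrt ?R cs"
    by (rule ex_sorted_wrt[OF tot _ S]) (auto dest: transD[OF tr])
  moreover have "x = y" if "?R x y" "?R y x" for x y
    using that tr irr by (meson irreflD transD)
  ultimately show ?thesis
    by (metis (no_types, lifting) sorted_wrt_unique[of ?R])
qed

end

theory Submission
  imports Defs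
begin

text \<open>
  A word \<open>u\<close> clusters iff its bi-infinite periodic repetition satisfies the order condition: if
  \<open>x z y\<close> and \<open>x' z y'\<close> are factors with \<open>x \<noteq> x'\<close> and \<open>y \<noteq> y'\<close>, the two comparisons agree. In
  the repetition \<open>U\<close> of the image of \<open>v\<close>, the word \<open>w\<close> occurs exactly at the block boundaries. If
  \<open>z\<close> avoids \<open>w\<close>, then \<open>x z y\<close> and \<open>x' z y'\<close> lie inside complete return words, hence in \<open>L\<close>, and the
  order condition of \<open>L\<close> applies. If \<open>z\<close> contains \<open>w\<close>, the first and the last occurrence of \<open>w\<close> in \<open>z\<close>
  delimit the image of a common factor of the repetition of \<open>v\<close>, and the letters at which the two
  occurrences of \<open>z\<close> stop agreeing are those that decide the derived orders of the neighbouring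
  letters; every instance of the order condition for \<open>v\<close> arises in this way.
\<close>

section \<open>First differences\<close>

lemma not_first_diff_less_refl: "\<not> first_diff_less r u u"
  by (simp add: first_diff_less_def)

lemma first_diff_less_decomp:
  assumes "b \<noteq> c"
  shows "first_diff_less r (as @ b # bs) (as @ c # cs) \<longleftrightarrow> (b, c) \<in> r"
proof
  assume "first_diff_less r (as @ b # bs) (as @ c # cs)"
  then obtain k where k: "take k (as @ b # bs) = take k (as @ c # cs)"
    "(as @ b # bs) ! k \<noteq> (as @ c # cs) ! k" "((as @ b # bs) ! k, (as @ c # cs) ! k) \<in> r"
    unfolding first_diff_less_def by blast
  have "\<not> k < length as" using k(2) by (auto simp: nth_append)
  moreover have "\<not> length as < k"
  proof
    assume "length as < k"
    then have "take k (as @ b # bs) ! length as = b" "take k (as @ c # cs) ! length as = c"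
      by (simp_all only: nth_take nth_append_length)
    then show False using k(1) assms by simp
  qed
  ultimately have "k = length as" by simp
  then show "(b, c) \<in> r" using k(3) by simp
next
  assume "(b, c) \<in> r"
  then show "first_diff_less r (as @ b # bs) (as @ c # cs)"
    unfolding first_diff_less_def using assms by (intro exI[of _ "length as"]) auto
qed

lemma first_diff_less_append_parallel:
  assumes "parallel u v"
  shows "first_diff_less r (u @ x) (v @ y) \<longleftrightarrow> first_diff_less r u v"
  using parallel_decomp[OF assms] by (auto simp: first_diff_less_decomp)

lemma first_diff_less_prepend_parallel:
  assumes "parallel u v"
  shows "first_diff_less r (x @ u) (x @ v) \<longleftrightarrow> first_diff_less r u v"
proof -
  obtain as b bs c cs where *: "b \<noteq> c" "u = as @ b # bs" "v = as @ c # cs"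
    using parallel_decomp[OF assms] by blast
  show ?thesis
    using first_diff_less_decomp[OF *(1), of r "x @ as" bs cs]
      first_diff_less_decomp[OF *(1), of r as bs cs] * by simp
qed

lemma parallel_first_diff:
  assumes "parallel u v"
  obtains m where "m < length u" "m < length v" "\<And>t. t < m \<Longrightarrow> u ! t = v ! t" "u ! m \<noteq> v ! m"
    "\<And>r. first_diff_less r u v \<longleftrightarrow> (u ! m, v ! m) \<in> r"
proof -
  obtain as b bs c cs where *: "b \<noteq> c" "u = as @ b # bs" "v = as @ c # cs"
    using parallel_decomp[OF assms] by blast
  show thesis
    by (rule that[of "length as"]) (use * in \<open>auto simp: nth_append first_diff_less_decomp\<close>)
qed

text \<open>The smaller of the two difference positions is the first difference of the outer pair;
  when they coincide, transitivity of \<open>r\<close> decides.\<close>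

lemma first_diff_less_trans:
  assumes "trans r" "irrefl r" "first_diff_less r u v" "first_diff_less r v z"
  shows "first_diff_less r u z"
proof -
  obtain k where k: "k < length u" "k < length v" "take k u = take k v" "(u ! k, v ! k) \<in> r"
    using assms(3) by (auto simp: first_diff_less_def)
  obtain l where l: "l < length v" "l < length z" "take l v = take l z" "(v ! l, z ! l) \<in> r"
    using assms(4) by (auto simp: first_diff_less_def)
  define m where "m = min k l"
  have "take m u = take m v" "take m v = take m z"
    using arg_cong[OF k(3), of "take m"] arg_cong[OF l(3), of "take m"]
    by (simp_all add: m_def min.commute min.left_commute)
  moreover have "(u ! m, z ! m) \<in> r"
  proof (cases k l rule: linorder_cases)
    case less
    then have "v ! k = z ! k" using l(3) by (metis nth_take)
    then show ?thesis using less k(4) by (simp add: m_def)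
  next
    case equal
    then show ?thesis using k(4) l(4) assms(1) by (auto simp: m_def dest: transD)
  next
    case greater
    then have "u ! l = v ! l" using k(3) by (metis nth_take)
    then show ?thesis using greater l(4) by (simp add: m_def)
  qed
  moreover have "m < length u" "m < length z" using k l by (auto simp: m_def)
  ultimately show ?thesis
    unfolding first_diff_less_def using assms(2) by (metis irreflD)
qed

text \<open>Totality comes from \<open>parallel\<close>: neither word is a prefix of the other, so a
  position present in both decides.\<close>

lemma strict_linear_order_on_first_diff_less:
  assumes r: "strict_linear_order_on A r"
    and in_A: "\<And>a. a \<in> A' \<Longrightarrow> f a \<in> lists A"
    and par: "\<And>a b. a \<in> A' \<Longrightarrow> b \<in> A' \<Longrightarrow> a \<noteq> b \<Longrightarrow> parallel (f a) (f b)"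
  shows "strict_linear_order_on A' {(a, b). a \<in> A' \<and> b \<in> A' \<and> first_diff_less r (f a) (f b)}"
proof -
  have tr: "trans r" "irrefl r" and tot: "total_on A r"
    using r by (auto simp: strict_linear_order_on_def)
  have "first_diff_less r (f a) (f b) \<or> first_diff_less r (f b) (f a)"
    if ab: "a \<in> A'" "b \<in> A'" "a \<noteq> b" for a b
  proof -
    obtain as x xs y ys where *: "x \<noteq> y" "f a = as @ x # xs" "f b = as @ y # ys"
      using parallel_decomp[OF par[OF ab]] by blast
    then have "x \<in> A" "y \<in> A" using in_A[OF ab(1)] in_A[OF ab(2)] by auto
    then have "(x, y) \<in> r \<or> (y, x) \<in> r" using tot *(1) by (auto simp: total_on_def)
    then show ?thesis using * by (auto simp: first_diff_less_decomp)
  qed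
  then show ?thesis
    unfolding strict_linear_order_on_def
    by (auto simp: total_on_def irrefl_def trans_def intro: first_diff_less_trans[OF tr])
       (auto simp: first_diff_less_def)
qed

section \<open>Clustering as an order condition on the periodic word\<close>

text \<open>A pair of occurrences of a factor is encoded by one occurrence and the shift to the other.\<close>

definition seq_order_condition ::
    "('a \<times> 'a) set \<Rightarrow> ('a \<times> 'a) set \<Rightarrow> (int \<Rightarrow> 'a) \<Rightarrow> bool" where
  "seq_order_condition rA rD U \<longleftrightarrow>
     (\<forall>i e d. i \<le> e \<and> (\<forall>x\<in>{i..<e}. U x = U (x + d)) \<and>
        U (i - 1) \<noteq> U (i - 1 + d) \<and> U e \<noteq> U (e + d) \<longrightarrow>
        ((U (i - 1), U (i - 1 + d)) \<in> rA \<longleftrightarrow> (U e, U (e + d)) \<in> rD))"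

definition periodic :: "'a list \<Rightarrow> int \<Rightarrow> 'a" where
  "periodic u i = u ! nat (i mod int (length u))"

lemma periodic_in: "u \<noteq> [] \<Longrightarrow> periodic u i \<in> set u"
  unfolding periodic_def by (intro nth_mem) (simp add: nat_less_iff)

lemma periodic_add_mult [simp]: "periodic u (q * int (length u) + i) = periodic u i"
  by (simp add: periodic_def)

lemma periodic_mod: "periodic u (i mod int (length u) + t) = periodic u (i + t)"
  by (simp add: periodic_def mod_simps)

lemma periodic_nth: "t < length u \<Longrightarrow> periodic u (int t) = u ! t"
  by (simp add: periodic_def)

lemma rotate_nth_periodic:
  assumes "t < length u"
  shows "rotate i u ! t = periodic u (int i + int t)"
  using assms unfolding periodic_def
  by (simp add: nth_rotate flip: of_nat_add of_nat_mod)

text \<open>The last letter of a conjugate is the left neighbour of its starting position in the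
  repetition; this turns the transform into a statement about left neighbours of factors.\<close>

lemma last_rotate_periodic:
  assumes "u \<noteq> []"
  shows "last (rotate i u) = periodic u (int i - 1)"
proof -
  have "last (rotate i u) = rotate i u ! (length u - 1)"
    using assms by (simp add: last_conv_nth)
  also have "\<dots> = periodic u (int i + int (length u - 1))"
    using assms by (intro rotate_nth_periodic) auto
  also have "int i + int (length u - 1) = 1 * int (length u) + (int i - 1)"
    using assms by (simp add: of_nat_diff Suc_leI)
  finally show ?thesis by (simp only: periodic_add_mult)
qed

text \<open>The conjugate starting at \<open>i\<close> ends with the letter at \<open>i - 1\<close>,
  so the list of last letters is itself a conjugate of \<open>u\<close>.\<close>

lemma mset_map_last_conjugates: "mset (map last (conjugates u)) = mset u"
proof (cases "u = []")
  case False
  have "map last (conjugates u) = rotate (length u - 1) u"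
  proof (rule nth_equalityI)
    fix i assume "i < length (map last (conjugates u))"
    then have i: "i < length u" by (simp add: conjugates_def)
    have "int (length u - 1) + int i = 1 * int (length u) + (int i - 1)"
      using False by (simp add: of_nat_diff Suc_leI)
    then show "map last (conjugates u) ! i = rotate (length u - 1) u ! i"
      using False i
      by (simp only: rotate_nth_periodic periodic_add_mult) (simp add: conjugates_def last_rotate_periodic)
  qed (simp add: conjugates_def)
  moreover have "mset (rotate k u) = mset u" for k
    by (simp add: rotate_drop_take flip: mset_append) (metis append_take_drop_id mset_append union_commute)
  ultimately show ?thesis by simp
qed (simp add: conjugates_def)

lemma lexord_same_length:
  assumes "length u = length v" "irrefl r"
  shows "(u, v) \<in> lexord r \<longleftrightarrow> first_diff_less r u v"
proof
  assume "(u, v) \<in> lexord r"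
  then show "first_diff_less r u v"
    unfolding lexord_def using assms
    by (auto simp: first_diff_less_decomp irrefl_def)
       (metis first_diff_less_decomp)
next
  assume "first_diff_less r u v"
  then obtain k where "k < length u" "k < length v" "take k u = take k v" "(u ! k, v ! k) \<in> r"
    by (auto simp: first_diff_less_def)
  then show "(u, v) \<in> lexord r" by (auto simp: lexord_take_index_conv)
qed

section \<open>Clustering as sortedness of the transform\<close>

lemma sorted_wrt_replicate_blocks:
  assumes "sorted_wrt (\<lambda>x y. (x, y) \<in> r) cs"
  shows "sorted_wrt (\<lambda>x y. x = y \<or> (x, y) \<in> r) (concat (map (\<lambda>c. replicate (f c) c) cs))"
  using assms
proof (induction cs)
  case (Cons c cs)
  have "sorted_wrt (\<lambda>x y. x = y \<or> (x, y) \<in> r) (replicate (f c) c)"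
    by (simp add: sorted_wrt_iff_nth_less)
  with Cons show ?case by (auto simp: sorted_wrt_append)
qed simp

lemma mset_replicate_blocks:
  assumes "distinct cs" "set u \<subseteq> set cs"
  shows "mset (concat (map (\<lambda>c. replicate (count_list u c) c) cs)) = mset u"
proof (rule multiset_eqI)
  fix x
  have "count (mset (concat (map (\<lambda>c. replicate (f c) c) cs))) x =
      (if x \<in> set cs then f x else 0)" if "distinct cs" for f and cs :: "'a list"
    using that by (induction cs) auto
  from this[OF assms(1), of "count_list u"]
  show "count (mset (concat (map (\<lambda>c. replicate (count_list u c) c) cs))) x = count (mset u) x"
    using assms(2) by (auto simp: count_mset count_list_0_iff)
qed

text \<open>The transform and the concatenated blocks are both permutations of \<open>u\<close>, and
  the blocks are sorted. A sorted permutation is unique, so sortedness alone forces the block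
  form.\<close>

lemma clusters_iff_sorted_bwt:
  assumes fin: "finite A" and rA: "strict_linear_order_on A rA"
    and rD: "strict_linear_order_on A rD" and u: "u \<in> lists A"
  shows "clusters A rA rD u \<longleftrightarrow> sorted_wrt (\<lambda>x y. x = y \<or> (x, y) \<in> rA) (bwt rD u)"
proof -
  let ?R = "\<lambda>x y. x = y \<or> (x, y) \<in> rA"
  have trA: "trans rA" "irrefl rA" "total_on A rA"
    using rA by (auto simp: strict_linear_order_on_def)
  have "mset (sorted_conjugates rD u) = mset (conjugates u)"
    using theI'[OF ex1_sorted_conjugates[OF rD u]] unfolding sorted_conjugates_def by blast
  then have mset_bwt: "mset (bwt rD u) = mset u"
    unfolding bwt_def using mset_map_last_conjugates[of u] by simp
  show ?thesis
  proof
    assume "clusters A rA rD u"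
    then show "sorted_wrt ?R (bwt rD u)"
      unfolding clusters_def by (auto intro: sorted_wrt_replicate_blocks)
  next
    assume sorted: "sorted_wrt ?R (bwt rD u)"
    obtain xs where xs: "set xs = A" "distinct xs" using finite_distinct_list[OF fin] by blast
    have "\<exists>cs. mset cs = mset xs \<and> sorted_wrt ?R cs"
      by (rule ex_sorted_wrt[of A]) (use trA xs in \<open>auto simp: total_on_def dest: transD\<close>)
    then obtain cs where "mset cs = mset xs" and cs: "sorted_wrt ?R cs" by blast
    then have cs': "set cs = A" "distinct cs"
      using xs by (metis mset_eq_setD, metis mset_eq_imp_distinct_iff)
    have srt: "sorted_wrt (\<lambda>x y. (x, y) \<in> rA) cs"
      using cs cs'(2) unfolding sorted_wrt_iff_nth_less
      by (metis distinct_conv_nth less_irrefl less_trans)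
    have mset_cs: "mset (concat (map (\<lambda>c. replicate (count_list u c) c) cs)) = mset u"
      using u cs' by (intro mset_replicate_blocks) auto
    have "bwt rD u = concat (map (\<lambda>c. replicate (count_list u c) c) cs)"
      by (rule sorted_wrt_unique[of ?R])
         (use trA sorted sorted_wrt_replicate_blocks[OF srt] mset_bwt mset_cs
            in \<open>auto simp: irrefl_def dest: transD\<close>)
    then show "clusters A rA rD u" unfolding clusters_def using cs' srt by blast
  qed
qed

text \<open>Conjugates that tie are equal and so have the same last letter; hence the sorted list
  can be replaced by a condition on pairs of conjugates.\<close>

lemma sorted_bwt_iff:
  assumes rD: "strict_linear_order_on A rD" and u: "u \<in> lists A"
  shows "sorted_wrt (\<lambda>x y. x = y \<or> (x, y) \<in> rA) (bwt rD u) \<longleftrightarrow>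
    (\<forall>c\<in>set (conjugates u). \<forall>c'\<in>set (conjugates u). (c, c') \<in> lexord rD \<longrightarrow>
        last c = last c' \<or> (last c, last c') \<in> rA)"
proof -
  define cs where "cs = sorted_conjugates rD u"
  have cs: "mset cs = mset (conjugates u)"
      "sorted_wrt (\<lambda>x y. x = y \<or> (x, y) \<in> lexord rD) cs"
    using theI'[OF ex1_sorted_conjugates[OF rD u]] unfolding sorted_conjugates_def cs_def by blast+
  have set: "set (conjugates u) = set cs" using cs(1) by (metis mset_eq_setD)
  have tr: "trans (lexord rD)" and irr: "irrefl (lexord rD)"
    using rD by (auto simp: strict_linear_order_on_def irrefl_def intro: lexord_trans transI
        dest: lexord_irreflexive[rotated])
  show ?thesis
  proof
    assume s: "sorted_wrt (\<lambda>x y. x = y \<or> (x, y) \<in> rA) (bwt rD u)"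
    show "\<forall>c\<in>set (conjugates u). \<forall>c'\<in>set (conjugates u). (c, c') \<in> lexord rD \<longrightarrow>
        last c = last c' \<or> (last c, last c') \<in> rA"
    proof (intro ballI impI)
      fix c c' assume c: "c \<in> set (conjugates u)" "c' \<in> set (conjugates u)" "(c, c') \<in> lexord rD"
      then obtain i j where ij: "i < length cs" "j < length cs" "c = cs ! i" "c' = cs ! j"
        by (auto simp: set in_set_conv_nth)
      have "\<not> j \<le> i"
      proof
        assume "j \<le> i"
        then have "c' = c \<or> (c', c) \<in> lexord rD"
          using cs(2) ij unfolding sorted_wrt_iff_nth_less by (cases "i = j") auto
        then show False using c(3) tr irr by (meson irreflD transD)
      qed
      then show "last c = last c' \<or> (last c, last c') \<in> rA"
        using s ij unfolding sorted_wrt_iff_nth_less bwt_def cs_def[symmetric] by auto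
    qed
  next
    assume *: "\<forall>c\<in>set (conjugates u). \<forall>c'\<in>set (conjugates u). (c, c') \<in> lexord rD \<longrightarrow>
        last c = last c' \<or> (last c, last c') \<in> rA"
    show "sorted_wrt (\<lambda>x y. x = y \<or> (x, y) \<in> rA) (bwt rD u)"
      unfolding bwt_def cs_def[symmetric] sorted_wrt_map
      by (rule sorted_wrt_mono_rel[OF _ cs(2)]) (use * set in auto)
  qed
qed

text \<open>Two conjugates are two positions in the repetition: their first difference ends a common
  factor on the right, and their last letters are its left neighbours. Conversely, the two
  occurrences in an instance of the order condition start, modulo the period, two
  conjugates.\<close>

lemma clusters_iff_seq_order_condition:
  assumes fin: "finite A" and rA: "strict_linear_order_on A rA"
    and rD: "strict_linear_order_on A rD" and u: "u \<in> lists A" "u \<noteq> []"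
  shows "clusters A rA rD u \<longleftrightarrow> seq_order_condition rA rD (periodic u)"
proof -
  let ?U = "periodic u" and ?n = "int (length u)"
  have npos: "?n > 0" using u by simp
  have ordA: "trans rA" "irrefl rA" "total_on A rA" and ordD: "trans rD" "irrefl rD" "total_on A rD"
    using rA rD by (auto simp: strict_linear_order_on_def)
  have U: "?U i \<in> A" for i using periodic_in[OF u(2), of i] u(1) by auto
  show ?thesis unfolding clusters_iff_sorted_bwt[OF fin rA rD u(1)] sorted_bwt_iff[OF rD u(1)]
  proof
    assume *: "\<forall>c\<in>set (conjugates u). \<forall>c'\<in>set (conjugates u). (c, c') \<in> lexord rD \<longrightarrow>
        last c = last c' \<or> (last c, last c') \<in> rA"
    \<comment> \<open>One implication for all shifts suffices: the other follows by exchanging the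
      two occurrences, that is, by replacing \<open>d\<close> with \<open>- d\<close>.\<close>
    have imp: "(?U (i - 1), ?U (i - 1 + d)) \<in> rA"
      if ie: "i \<le> e" and agree: "\<forall>x\<in>{i..<e}. ?U x = ?U (x + d)"
        and dif: "?U (i - 1) \<noteq> ?U (i - 1 + d)" and e: "(?U e, ?U (e + d)) \<in> rD" for i e d
    proof -
      define a b m where "a = nat (i mod ?n)" and "b = nat ((i + d) mod ?n)" and "m = nat (e - i)"
      have ab: "a < length u" "b < length u" "int a = i mod ?n" "int b = (i + d) mod ?n"
        using npos unfolding a_def b_def by (simp_all add: nat_less_iff)
      have ra: "rotate a u ! t = ?U (i + int t)" "rotate b u ! t = ?U (i + int t + d)"
        if "t < length u" for t
        using that ab(3,4) periodic_mod[of u i "int t"] periodic_mod[of u "i + d" "int t"]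
        by (simp_all add: rotate_nth_periodic algebra_simps)
      have la: "last (rotate a u) = ?U (i - 1)" "last (rotate b u) = ?U (i - 1 + d)"
        using u(2) ab(3,4) periodic_mod[of u i "-1"] periodic_mod[of u "i + d" "-1"]
        by (simp_all add: last_rotate_periodic algebra_simps)
      \<comment> \<open>A factor of at least one period would contain the position one period after
        \<open>i - 1\<close>, where the two occurrences differ.\<close>
      have m: "m < length u"
      proof (rule ccontr)
        assume "\<not> m < length u"
        then have "e - i \<ge> ?n" using ie by (simp add: m_def le_nat_iff)
        then have "i + ?n - 1 \<in> {i..<e}" using npos by auto
        then have "?U (i + ?n - 1) = ?U (i + ?n - 1 + d)" using agree by blast
        moreover have "i + ?n - 1 = 1 * ?n + (i - 1)" "i + ?n - 1 + d = 1 * ?n + (i - 1 + d)"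
          by simp_all
        ultimately show False using dif by (metis periodic_add_mult)
      qed
      have e_eq: "e = i + int m" using ie by (simp add: m_def)
      have "take m (rotate a u) = take m (rotate b u)"
      proof (rule nth_equalityI)
        fix t assume "t < length (take m (rotate a u))"
        then have t: "t < m" "t < length u" by auto
        then have "i + int t \<in> {i..<e}" using e_eq by auto
        with agree t show "take m (rotate a u) ! t = take m (rotate b u) ! t"
          by (simp add: ra)
      qed simp
      moreover have "(rotate a u ! m, rotate b u ! m) \<in> rD"
        using m e e_eq by (simp add: ra)
      ultimately have "(rotate a u, rotate b u) \<in> lexord rD"
        using m by (auto simp: lexord_take_index_conv)
      moreover have "rotate a u \<in> set (conjugates u)" "rotate b u \<in> set (conjugates u)"
        using ab by (auto simp: conjugates_def)
      ultimately have "last (rotate a u) = last (rotate b u) \<or>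
          (last (rotate a u), last (rotate b u)) \<in> rA"
        using * by blast
      then show ?thesis using la dif by simp
    qed
    show "seq_order_condition rA rD ?U"
      unfolding seq_order_condition_def
    proof (intro allI impI iffI; elim conjE)
      fix i e d
      assume ie: "i \<le> e" and agree: "\<forall>x\<in>{i..<e}. ?U x = ?U (x + d)"
        and dif: "?U (i - 1) \<noteq> ?U (i - 1 + d)" "?U e \<noteq> ?U (e + d)"
      show "(?U (i - 1), ?U (i - 1 + d)) \<in> rA" if "(?U e, ?U (e + d)) \<in> rD"
        using imp[OF ie agree dif(1) that] .
      show "(?U e, ?U (e + d)) \<in> rD" if A: "(?U (i - 1), ?U (i - 1 + d)) \<in> rA"
      proof (rule ccontr)
        assume "(?U e, ?U (e + d)) \<notin> rD"
        then have e: "(?U (e + d), ?U (e + d + - d)) \<in> rD"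
          using dif(2) U ordD(3) by (auto simp: total_on_def)
        have "\<forall>x\<in>{i + d..<e + d}. ?U x = ?U (x + - d)"
        proof
          fix x assume "x \<in> {i + d..<e + d}"
          then have "x - d \<in> {i..<e}" by auto
          then have "?U (x - d) = ?U (x - d + d)" using agree by blast
          then show "?U x = ?U (x + - d)" by simp
        qed
        moreover have "?U (i + d - 1) \<noteq> ?U (i + d - 1 + - d)"
          using dif(1) by (simp add: algebra_simps)
        ultimately have "(?U (i + d - 1), ?U (i + d - 1 + - d)) \<in> rA"
          using imp[of "i + d" "e + d" "- d"] ie e by simp
        then have "(?U (i - 1 + d), ?U (i - 1)) \<in> rA" by (simp add: algebra_simps)
        then show False using A ordA by (meson irreflD transD)
      qed
    qed
  next
    assume oc: "seq_order_condition rA rD ?U"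
    show "\<forall>c\<in>set (conjugates u). \<forall>c'\<in>set (conjugates u). (c, c') \<in> lexord rD \<longrightarrow>
        last c = last c' \<or> (last c, last c') \<in> rA"
    proof (intro ballI impI)
      fix c c' assume c: "c \<in> set (conjugates u)" "c' \<in> set (conjugates u)" "(c, c') \<in> lexord rD"
      then obtain i j where ij: "c = rotate i u" "c' = rotate j u" by (auto simp: conjugates_def)
      define d where "d = int j - int i"
      have "first_diff_less rD c c'"
        using c(3) ij ordD(2) by (subst lexord_same_length[symmetric]) auto
      then obtain k where k: "k < length u" "take k c = take k c'" "c ! k \<noteq> c' ! k" "(c ! k, c' ! k) \<in> rD"
        unfolding first_diff_less_def ij by auto
      have nth: "c ! t = ?U (int i + int t)" "c' ! t = ?U (int i + int t + d)" if "t < length u" for t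
        using that by (simp_all add: ij rotate_nth_periodic d_def algebra_simps)
      have last: "last c = ?U (int i - 1)" "last c' = ?U (int i - 1 + d)"
        using u(2) by (simp_all add: ij last_rotate_periodic d_def)
      have agree: "\<forall>x\<in>{int i..<int i + int k}. ?U x = ?U (x + d)"
      proof
        fix x assume x: "x \<in> {int i..<int i + int k}"
        define t where "t = nat (x - int i)"
        have t: "x = int i + int t" "t < k" using x by (auto simp: t_def)
        then have "c ! t = c' ! t" using k(2) by (metis nth_take)
        then show "?U x = ?U (x + d)" using t k(1) by (simp add: nth)
      qed
      show "last c = last c' \<or> (last c, last c') \<in> rA"
        using oc[unfolded seq_order_condition_def, rule_format, of "int i" "int i + int k" d]
          agree k(1,3,4) unfolding last by (auto simp: nth)
    qed
  qed
qed

section \<open>Return words and derived orders\<close>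

text \<open>
  \<open>\<phi> a\<close> and \<open>\<psi> a\<close> are the prefix and the suffix return word read off the same
  complete return word \<open>\<phi> a @ w = w @ \<psi> a\<close>.
\<close>

locale return_words =
  fixes w :: "'a list" and A' :: "'b set" and \<phi> \<psi> :: "'b \<Rightarrow> 'a list"
  assumes complete: "a \<in> A' \<Longrightarrow> w @ \<psi> a = \<phi> a @ w"
    and nonempty: "a \<in> A' \<Longrightarrow> \<psi> a \<noteq> []"
    and no_inner: "a \<in> A' \<Longrightarrow> w @ \<psi> a = x @ w @ y \<Longrightarrow> x = [] \<or> y = []"
    and inj: "inj_on \<psi> A'"
begin

lemma length_eq: "a \<in> A' \<Longrightarrow> length (\<phi> a) = length (\<psi> a)"
  using complete[of a] by (metis add_left_imp_eq add.commute length_append)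

text \<open>If \<open>\<psi> a\<close> were a proper prefix of \<open>\<psi> b\<close>, the
  \<open>w\<close> at the end of \<open>w @ \<psi> a\<close> would lie strictly inside
  \<open>w @ \<psi> b\<close>.\<close>

lemma parallel_suffix_returns:
  assumes "a \<in> A'" "b \<in> A'" "a \<noteq> b"
  shows "parallel (\<psi> a) (\<psi> b)"
proof -
  have "a = b" if ab: "a \<in> A'" "b \<in> A'" "prefix (\<psi> a) (\<psi> b)" for a b
  proof -
    obtain z where z: "\<psi> b = \<psi> a @ z" using ab(3) by (auto simp: prefix_def)
    then have "w @ \<psi> b = \<phi> a @ w @ z" using complete[OF ab(1)] by (metis append.assoc)
    moreover have "\<phi> a \<noteq> []" using length_eq[OF ab(1)] nonempty[OF ab(1)] by auto
    ultimately have "z = []" using no_inner[OF ab(2)] by blast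
    then show ?thesis using z inj ab by (auto simp: inj_on_def)
  qed
  then show ?thesis using assms by (metis parallelI)
qed

text \<open>Mirror image: if \<open>\<phi> a\<close> were a proper suffix of
  \<open>\<phi> b\<close>, the \<open>w\<close> at the start of \<open>\<phi> a @ w\<close> would be
  an inner occurrence.\<close>

lemma parallel_rev_prefix_returns:
  assumes "a \<in> A'" "b \<in> A'" "a \<noteq> b"
  shows "parallel (rev (\<phi> a)) (rev (\<phi> b))"
proof -
  have "a = b" if ab: "a \<in> A'" "b \<in> A'" "prefix (rev (\<phi> a)) (rev (\<phi> b))" for a b
  proof -
    obtain z where z: "\<phi> b = z @ \<phi> a" using ab(3) by (auto simp: suffix_def simp flip: suffix_to_prefix)
    then have eq: "w @ \<psi> b = z @ w @ \<psi> a" using complete[OF ab(1)] complete[OF ab(2)] by simp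
    then have "z = []" using no_inner[OF ab(2)] nonempty[OF ab(1)] by blast
    then show ?thesis using eq inj ab by (auto simp: inj_on_def)
  qed
  then show ?thesis using assms by (metis parallelI)
qed

text \<open>The derived orders with the common \<open>w\<close> cancelled. They depend only on the
  complete return words, so they serve suffix and prefix return words alike.\<close>

definition ordA :: "('a \<times> 'a) set \<Rightarrow> ('b \<times> 'b) set" where
  "ordA r = {(a, b). a \<in> A' \<and> b \<in> A' \<and> first_diff_less r (rev (\<phi> a)) (rev (\<phi> b))}"

definition ordD :: "('a \<times> 'a) set \<Rightarrow> ('b \<times> 'b) set" where
  "ordD r = {(a, b). a \<in> A' \<and> b \<in> A' \<and> first_diff_less r (\<psi> a) (\<psi> b)}"

text \<open>Rewriting \<open>w @ \<psi> a\<close> as \<open>\<phi> a @ w\<close> puts the common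
  \<open>w\<close> at the right end, where the comparison skips it; in \<open>\<psi> a @ w\<close>
  the difference comes before \<open>w\<close> is reached.\<close>

lemma derived_orders_suffix: "derived_A r w A' \<psi> = ordA r" "derived_D r w A' \<psi> = ordD r"
proof -
  have "first_diff_less r (rev (w @ \<psi> a)) (rev (w @ \<psi> b)) \<longleftrightarrow>
      first_diff_less r (rev (\<phi> a)) (rev (\<phi> b))" if "a \<in> A'" "b \<in> A'" for a b
    using first_diff_less_prepend_parallel[OF parallel_rev_prefix_returns[OF that]]
    by (cases "a = b") (simp_all add: complete that not_first_diff_less_refl)
  then show "derived_A r w A' \<psi> = ordA r" by (auto simp: derived_A_def ordA_def)
  have "first_diff_less r (\<psi> a @ w) (\<psi> b @ w) \<longleftrightarrow> first_diff_less r (\<psi> a) (\<psi> b)"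
    if "a \<in> A'" "b \<in> A'" for a b
    using first_diff_less_append_parallel[OF parallel_suffix_returns[OF that]]
    by (cases "a = b") (simp_all add: not_first_diff_less_refl)
  then show "derived_D r w A' \<psi> = ordD r" by (auto simp: derived_D_def ordD_def)
qed

text \<open>Now the comparison from the left skips a common \<open>w\<close>, and the one from the
  right is decided before \<open>w\<close>.\<close>

lemma derived_orders_prefix: "derived_A r w A' \<phi> = ordA r" "derived_D r w A' \<phi> = ordD r"
proof -
  have "first_diff_less r (rev (w @ \<phi> a)) (rev (w @ \<phi> b)) \<longleftrightarrow>
      first_diff_less r (rev (\<phi> a)) (rev (\<phi> b))" if "a \<in> A'" "b \<in> A'" for a b
    using first_diff_less_append_parallel[OF parallel_rev_prefix_returns[OF that]]
    by (cases "a = b") (simp_all add: not_first_diff_less_refl)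
  then show "derived_A r w A' \<phi> = ordA r" by (auto simp: derived_A_def ordA_def)
  have "first_diff_less r (\<phi> a @ w) (\<phi> b @ w) \<longleftrightarrow> first_diff_less r (\<psi> a) (\<psi> b)"
    if "a \<in> A'" "b \<in> A'" for a b
    using first_diff_less_prepend_parallel[OF parallel_suffix_returns[OF that]]
    by (cases "a = b") (simp_all add: complete[symmetric] that not_first_diff_less_refl)
  then show "derived_D r w A' \<phi> = ordD r" by (auto simp: derived_D_def ordD_def)
qed

end

section \<open>Transfer of the order condition\<close>

text \<open>
  \<open>p k\<close> is the position just after the \<open>k\<close>-th occurrence of \<open>w\<close> in \<open>U\<close>; the next occurrence is
  reached by reading \<open>\<psi> (V k)\<close>.
\<close>

locale decomposed_sequence = return_words w A' \<phi> \<psi>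
  for w :: "'a list" and A' :: "'b set" and \<phi> \<psi> :: "'b \<Rightarrow> 'a list" +
  fixes U :: "int \<Rightarrow> 'a" and V :: "int \<Rightarrow> 'b" and p :: "int \<Rightarrow> int"
  assumes V_in: "V k \<in> A'"
    and p_Suc: "p (k + 1) = p k + int (length (\<psi> (V k)))"
    and window: "t < length w + length (\<psi> (V k)) \<Longrightarrow>
      U (p k - int (length w) + int t) = (w @ \<psi> (V k)) ! t"
begin

section \<open>Positions of the occurrences of \<open>w\<close>\<close>

abbreviation lw :: int where "lw \<equiv> int (length w)"

lemma U_window:
  assumes "p k - lw \<le> x" "x < p (k + 1)"
  shows "U x = (w @ \<psi> (V k)) ! nat (x - p k + lw)"
proof -
  have "nat (x - p k + lw) < length w + length (\<psi> (V k))"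
    using assms p_Suc[of k] by linarith
  from window[OF this] show ?thesis using assms by simp
qed

lemma p_less: "p k < p (k + 1)"
  using p_Suc[of k] nonempty[OF V_in[of k]] by simp

text \<open>Suffix return words are nonempty, so consecutive positions are at least 1 apart. Hence
  \<open>p\<close> is unbounded in both directions.\<close>

lemma p_growth: "k \<le> l \<Longrightarrow> p k + (l - k) \<le> p l"
proof (induction l rule: int_ge_induct)
  case (step l)
  then show ?case using p_less[of l] by simp
qed simp

lemma p_mono: "k \<le> l \<Longrightarrow> p k \<le> p l"
  using p_growth[of k l] by simp

lemma p_less_cancel: "p k < p l \<Longrightarrow> k < l"
  using p_mono[of l k] by linarith

lemma p_locate: obtains k where "p k \<le> x" "x < p (k + 1)"
proof -
  \<comment> \<open>For \<open>a \<le> 0\<close> the growth bound gives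
    \<open>p a \<le> p 0 + a\<close>, which is at most \<open>x\<close> by this choice.\<close>
  define a where "a = min 0 (x - p 0)"
  have a: "p a \<le> x" using p_growth[of a 0] by (auto simp: a_def min_def split: if_splits)
  define N where "N = nat (x - p a)"
  have ex: "\<exists>n. x < p (a + int n + 1)"
  proof
    show "x < p (a + int N + 1)"
      using p_growth[of a "a + int N + 1"] a by (simp add: N_def)
  qed
  define n where "n = (LEAST n. x < p (a + int n + 1))"
  have n: "x < p (a + int n + 1)" unfolding n_def using ex by (rule LeastI_ex)
  have "p (a + int n) \<le> x"
  proof (cases n)
    case (Suc m)
    then have "\<not> x < p (a + int m + 1)" unfolding n_def by (metis lessI not_less_Least)
    then show ?thesis using Suc by (simp add: algebra_simps)
  qed (simp add: a)
  then show thesis using that n by blast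
qed

lemma w_before: "t < length w \<Longrightarrow> U (p k - lw + int t) = w ! t"
  using window[of t k] by (simp add: nth_append)

lemma w_shift:
  assumes "p l = p k + d" "x \<in> {p k - lw..<p k}"
  shows "U x = U (x + d)"
proof -
  define t where "t = nat (x - (p k - lw))"
  have t: "p k - lw + int t = x" "p l - lw + int t = x + d" "t < length w"
    using assms by (auto simp: t_def)
  show ?thesis using w_before[OF t(3), of k] w_before[OF t(3), of l] unfolding t(1,2) by simp
qed

text \<open>Complete return words have no inner occurrence of \<open>w\<close>, so the positions
  \<open>p k\<close> catch every occurrence in \<open>U\<close>. Here \<open>s\<close> is the
  position just after the occurrence.\<close>

lemma w_occurrence:
  assumes "\<And>t. t < length w \<Longrightarrow> U (s - lw + int t) = w ! t"
  obtains k where "p k = s"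
proof -
  obtain k where k: "p k \<le> s" "s < p (k + 1)" by (rule p_locate)
  let ?b = "w @ \<psi> (V k)"
  define n where "n = nat (s - p k)"
  have n: "s = p k + int n" "n < length (\<psi> (V k))" using k p_Suc[of k] by (auto simp: n_def)
  have "take (length w) (drop n ?b) = w"
  proof (rule nth_equalityI)
    show len: "length (take (length w) (drop n ?b)) = length w" using n by simp
    fix t assume "t < length (take (length w) (drop n ?b))"
    then have t: "t < length w" using len by simp
    have "?b ! (n + t) = U (p k - lw + int (n + t))"
      using window[of "n + t" k] n(2) t by simp
    also have "\<dots> = w ! t" using assms[OF t] n(1) by (simp add: algebra_simps)
    finally have "?b ! (n + t) = w ! t" .
    moreover have "n \<le> length ?b" using n(2) by simp
    ultimately show "take (length w) (drop n ?b) ! t = w ! t" by (simp only: nth_take[OF t] nth_drop)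
  qed
  then have "?b = take n ?b @ w @ drop (length w) (drop n ?b)"
    by (metis append_take_drop_id)
  then have "take n ?b = [] \<or> drop (length w) (drop n ?b) = []"
    by (rule no_inner[OF V_in])
  \<comment> \<open>An empty remainder would make the occurrence end at \<open>p (k + 1)\<close>,
    but \<open>s < p (k + 1)\<close>.\<close>
  then have "n = 0" using n(2) nonempty[OF V_in[of k]] by auto
  then show thesis using n(1) that[of k] by simp
qed

text \<open>Suffix return words of distinct letters are parallel, so reading on from
  \<open>p k\<close> and \<open>p l\<close> meets a difference before either block ends, and this
  difference decides the derived order.\<close>

lemma diff_right:
  assumes d: "p l = p k + d" and V: "V k \<noteq> V l"
  obtains e where "p k \<le> e" "e < p (k + 1)" "\<And>x. x \<in> {p k..<e} \<Longrightarrow> U x = U (x + d)"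
    "U e \<noteq> U (e + d)" "\<And>r. (U e, U (e + d)) \<in> r \<longleftrightarrow> (V k, V l) \<in> ordD r"
proof -
  obtain m where m: "m < length (\<psi> (V k))" "m < length (\<psi> (V l))"
    "\<And>t. t < m \<Longrightarrow> \<psi> (V k) ! t = \<psi> (V l) ! t" "\<psi> (V k) ! m \<noteq> \<psi> (V l) ! m"
    "\<And>r. first_diff_less r (\<psi> (V k)) (\<psi> (V l)) \<longleftrightarrow> (\<psi> (V k) ! m, \<psi> (V l) ! m) \<in> r"
    using parallel_first_diff[OF parallel_suffix_returns[OF V_in V_in V]] by metis
  have val: "U (p k + int t) = \<psi> (V k) ! t" "U (p k + int t + d) = \<psi> (V l) ! t" if "t \<le> m" for t
    using window[of "length w + t" k] window[of "length w + t" l] that m(1,2) d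
    by (simp_all add: nth_append algebra_simps)
  show thesis
  proof (rule that[of "p k + int m"])
    fix x assume x: "x \<in> {p k..<p k + int m}"
    define t where "t = nat (x - p k)"
    have "x = p k + int t" "t < m" using x by (auto simp: t_def)
    then show "U x = U (x + d)" using val[of t] m(3) by simp
  next
    fix r
    show "(U (p k + int m), U (p k + int m + d)) \<in> r \<longleftrightarrow> (V k, V l) \<in> ordD r"
      using val[of m] m(5)[of r] V_in by (simp add: ordD_def)
  qed (use val[of m] m p_Suc[of k] in auto)
qed

text \<open>Since \<open>w @ \<psi> a = \<phi> a @ w\<close>, the word
  \<open>\<phi> (V (k - 1))\<close> stands directly to the left of the \<open>w\<close> ending at
  \<open>p k\<close>. It is compared backwards, and the agreement extends rightwards through
  \<open>w\<close> itself.\<close>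

lemma diff_left:
  assumes d: "p l = p k + d" and V: "V (k - 1) \<noteq> V (l - 1)"
  obtains i where "p (k - 1) - lw < i" "i \<le> p k - lw" "\<And>x. x \<in> {i..<p k} \<Longrightarrow> U x = U (x + d)"
    "U (i - 1) \<noteq> U (i - 1 + d)"
    "\<And>r. (U (i - 1), U (i - 1 + d)) \<in> r \<longleftrightarrow> (V (k - 1), V (l - 1)) \<in> ordA r"
proof -
  let ?a = "\<phi> (V (k - 1))" and ?b = "\<phi> (V (l - 1))"
  obtain m where m: "m < length ?a" "m < length ?b"
    "\<And>t. t < m \<Longrightarrow> rev ?a ! t = rev ?b ! t" "rev ?a ! m \<noteq> rev ?b ! m"
    "\<And>r. first_diff_less r (rev ?a) (rev ?b) \<longleftrightarrow> (rev ?a ! m, rev ?b ! m) \<in> r"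
    using parallel_first_diff[OF parallel_rev_prefix_returns[OF V_in V_in V]] by (metis length_rev)
  have block: "U (p j - lw - 1 - int t) = rev (\<phi> (V (j - 1))) ! t"
    if t: "t < length (\<phi> (V (j - 1)))" for t j
  proof -
    let ?c = "V (j - 1)"
    define s where "s = length (\<phi> ?c) - Suc t"
    have s: "s < length (\<phi> ?c)" "int s = int (length (\<phi> ?c)) - 1 - int t"
      using t by (auto simp: s_def)
    have len: "length (\<phi> ?c) = length (\<psi> ?c)" by (rule length_eq[OF V_in])
    have "U (p (j - 1) - lw + int s) = (w @ \<psi> ?c) ! s" using window[of s "j - 1"] s(1) len by simp
    also have "\<dots> = \<phi> ?c ! s" using s(1) by (simp add: complete[OF V_in] nth_append)
    also have "\<dots> = rev (\<phi> ?c) ! t" using t by (simp add: s_def rev_nth)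
    also have "p (j - 1) - lw + int s = p j - lw - 1 - int t"
      using p_Suc[of "j - 1"] s(2) len by simp
    finally show ?thesis .
  qed
  have val: "U (p k - lw - 1 - int t) = rev ?a ! t" "U (p k - lw - 1 - int t + d) = rev ?b ! t"
    if "t \<le> m" for t
    using block[of t k] block[of t l] that m(1,2) d by (simp_all add: algebra_simps)
  show thesis
  proof (rule that[of "p k - lw - int m"])
    fix x assume x: "x \<in> {p k - lw - int m..<p k}"
    show "U x = U (x + d)"
    proof (cases "x < p k - lw")
      case True
      define t where "t = nat (p k - lw - 1 - x)"
      have "x = p k - lw - 1 - int t" "t < m" using x True by (auto simp: t_def)
      then show ?thesis using val[of t] m(3) by simp
    next
      case False
      then show ?thesis using w_shift[OF d] x by simp
    qed
  next
    fix r
    show "(U (p k - lw - int m - 1), U (p k - lw - int m - 1 + d)) \<in> r \<longleftrightarrow>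
        (V (k - 1), V (l - 1)) \<in> ordA r"
      using val[of m] m(5)[of r] V_in by (simp add: ordA_def algebra_simps)
  next
    show "U (p k - lw - int m - 1) \<noteq> U (p k - lw - int m - 1 + d)"
      using val[of m] m(4) by (simp add: algebra_simps)
  qed (use m(1) p_Suc[of "k - 1"] length_eq[OF V_in[of "k - 1"]] in auto)
qed

lemma same_block:
  assumes d: "p l = p k + d" and V: "V k = V l"
  shows "p (l + 1) = p (k + 1) + d" and "x \<in> {p k - lw..<p (k + 1)} \<Longrightarrow> U x = U (x + d)"
proof -
  show p: "p (l + 1) = p (k + 1) + d" using d V by (simp add: p_Suc)
  assume "x \<in> {p k - lw..<p (k + 1)}"
  then show "U x = U (x + d)"
    using U_window[of k x] U_window[of l "x + d"] p d V by simp
qed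

lemma same_blocks:
  assumes "p (k + c) = p k + d" "k \<le> k'" "\<forall>t\<in>{k..<k'}. V t = V (t + c)"
  shows "p (k' + c) = p k' + d \<and> (\<forall>x\<in>{p k - lw..<p k'}. U x = U (x + d))"
  using assms(2,3)
proof (induction k' rule: int_ge_induct)
  case base
  then show ?case using assms(1) w_shift[OF assms(1)] by blast
next
  case (step k')
  then have IH: "p (k' + c) = p k' + d" "\<forall>x\<in>{p k - lw..<p k'}. U x = U (x + d)" by auto
  have "V k' = V (k' + c)" using step by auto
  note same = same_block[OF IH(1) this]
  have "U x = U (x + d)" if "x \<in> {p k - lw..<p (k' + 1)}" for x
    using that IH(2) same(2)[of x] by (cases "x < p k'") auto
  then show ?case using same(1) by (simp add: algebra_simps)
qed

text \<open>A common factor of \<open>V\<close> is mapped to its image, extended on both sides by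
  \<open>w\<close> and the agreeing parts of the neighbouring blocks. The letters where agreement
  stops are those that compare the neighbours in the derived orders.\<close>

lemma order_condition_derived:
  assumes "seq_order_condition rA rD U"
  shows "seq_order_condition (ordA rA) (ordD rD) V"
  unfolding seq_order_condition_def
proof (intro allI impI; elim conjE)
  fix k e c
  assume ke: "k \<le> e" and agree: "\<forall>x\<in>{k..<e}. V x = V (x + c)"
    and dif: "V (k - 1) \<noteq> V (k - 1 + c)" "V e \<noteq> V (e + c)"
  define d where "d = p (k + c) - p k"
  have d: "p (k + c) = p k + d" by (simp add: d_def)
  note same = same_blocks[OF d ke agree]
  have dif': "V (k - 1) \<noteq> V (k + c - 1)" using dif(1) by (simp add: algebra_simps)
  from diff_left[OF d dif'] obtain i where i: "i \<le> p k - lw"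
    "\<And>x. x \<in> {i..<p k} \<Longrightarrow> U x = U (x + d)" "U (i - 1) \<noteq> U (i - 1 + d)"
    "\<And>r. (U (i - 1), U (i - 1 + d)) \<in> r \<longleftrightarrow> (V (k - 1), V (k + c - 1)) \<in> ordA r" by metis
  from diff_right[OF conjunct1[OF same] dif(2)] obtain f where f: "p e \<le> f"
    "\<And>x. x \<in> {p e..<f} \<Longrightarrow> U x = U (x + d)" "U f \<noteq> U (f + d)"
    "\<And>r. (U f, U (f + d)) \<in> r \<longleftrightarrow> (V e, V (e + c)) \<in> ordD r" by metis
  have pe: "p k \<le> p e" using ke by (rule p_mono)
  have "\<forall>x\<in>{i..<f}. U x = U (x + d)"
  proof
    fix x assume "x \<in> {i..<f}"
    then consider "x \<in> {i..<p k}" | "x \<in> {p k - lw..<p e}" | "x \<in> {p e..<f}" by fastforce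
    then show "U x = U (x + d)" using i(2) f(2) same by cases auto
  qed
  moreover have "i \<le> f" using i(1) pe f(1) by simp
  ultimately have "(U (i - 1), U (i - 1 + d)) \<in> rA \<longleftrightarrow> (U f, U (f + d)) \<in> rD"
    using assms i(3) f(3) unfolding seq_order_condition_def by blast
  then show "(V (k - 1), V (k - 1 + c)) \<in> ordA rA \<longleftrightarrow> (V e, V (e + c)) \<in> ordD rD"
    using i(4) f(4) by (simp add: algebra_simps)
qed

text \<open>The converse passage: the part from the first to the last occurrence of \<open>w\<close>
  in the factor is decoded to a common factor of \<open>V\<close>, and the ends of the factor are
  recognised as the differences found in the neighbouring blocks.\<close>

lemma order_condition_with_w:
  assumes oc: "seq_order_condition (ordA rA) (ordD rD) V"
    and agree: "\<forall>x\<in>{i..<e}. U x = U (x + d)"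
    and dif: "U (i - 1) \<noteq> U (i - 1 + d)" "U e \<noteq> U (e + d)"
    and occ: "i + lw \<le> p k" "p k \<le> e"
  shows "(U (i - 1), U (i - 1 + d)) \<in> rA \<longleftrightarrow> (U e, U (e + d)) \<in> rD"
proof -
  \<comment> \<open>The occurrence ending at \<open>p k\<close> starts at \<open>p k - lw\<close>,
    so \<open>k0\<close> indexes the first one starting at \<open>i\<close> or later.\<close>
  obtain k0' where k0': "p k0' \<le> i + lw - 1" "i + lw - 1 < p (k0' + 1)" by (rule p_locate)
  define k0 where "k0 = k0' + 1"
  have k0: "p (k0 - 1) < i + lw" "i + lw \<le> p k0" using k0' by (auto simp: k0_def)
  have "k0 - 1 < k" using p_less_cancel[of "k0 - 1" k] k0(1) occ(1) by simp
  then have k0e: "p k0 \<le> e" using p_mono[of k0 k] occ(2) by simp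
  obtain k1 where k1: "p k1 \<le> e" "e < p (k1 + 1)" by (rule p_locate)
  have k01: "k0 \<le> k1" using p_less_cancel[of k0 "k1 + 1"] k0e k1(2) by simp
  \<comment> \<open>The first occurrence lies in the factor, so the shift carries it to another
    occurrence of \<open>w\<close>, which ends at some \<open>p l0\<close>.\<close>
  have "U (p k0 + d - lw + int t) = w ! t" if "t < length w" for t
  proof -
    have "p k0 - lw + int t \<in> {i..<e}" using that k0 k0e by auto
    then have "U (p k0 - lw + int t) = U (p k0 - lw + int t + d)" using agree by blast
    then show ?thesis using w_before[OF that, of k0] by (simp add: algebra_simps)
  qed
  then obtain l0 where "p l0 = p k0 + d" by (rule w_occurrence)
  define c where "c = l0 - k0"
  have base: "p (k0 + c) = p k0 + d" using \<open>p l0 = p k0 + d\<close> by (simp add: c_def)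
  \<comment> \<open>Distinct letters would produce a difference within a block contained in the
    factor, where the two occurrences agree.\<close>
  have same: "k' \<le> k1 \<Longrightarrow> p (k' + c) = p k' + d \<and> (\<forall>t\<in>{k0..<k'}. V t = V (t + c))"
    if "k0 \<le> k'" for k'
    using that
  proof (induction k' rule: int_ge_induct)
    case (step k')
    then have IH: "p (k' + c) = p k' + d" "\<forall>t\<in>{k0..<k'}. V t = V (t + c)" by auto
    have "V k' = V (k' + c)"
    proof (rule ccontr)
      assume "V k' \<noteq> V (k' + c)"
      then obtain f where f: "p k' \<le> f" "f < p (k' + 1)" "U f \<noteq> U (f + d)"
        using diff_right[OF IH(1)] by metis
      have "p k0 \<le> p k'" "p (k' + 1) \<le> p k1" using step by (auto intro: p_mono)
      then have "f \<in> {i..<e}" using f k1 k0 by auto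
      then show False using agree f(3) by blast
    qed
    moreover from same_block(1)[OF IH(1) this] have "p (k' + 1 + c) = p (k' + 1) + d"
      by (simp add: algebra_simps)
    moreover have "t \<in> {k0..<k'} \<or> t = k'" if "t \<in> {k0..<k' + 1}" for t using that by auto
    ultimately show ?case using IH(2) by blast
  qed (simp add: base)
  have p1: "p (k1 + c) = p k1 + d" and V01: "\<forall>t\<in>{k0..<k1}. V t = V (t + c)"
    using same[OF k01] by auto
  have pk01: "p k0 \<le> p k1" using k01 by (rule p_mono)
  have V1: "V k1 \<noteq> V (k1 + c)"
    using same_block(2)[OF p1, of e] dif(2) k1 by auto
  \<comment> \<open>Otherwise agreement would reach back to the start of the preceding
    \<open>w\<close>, which is at most \<open>i - 1\<close>.\<close>
  have V0: "V (k0 - 1) \<noteq> V (k0 + c - 1)"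
  proof
    assume V: "V (k0 - 1) = V (k0 + c - 1)"
    have "p (k0 + c - 1) = p (k0 - 1) + d"
      using p_Suc[of "k0 - 1"] p_Suc[of "k0 + c - 1"] V base by simp
    from same_block(2)[OF this V, of "i - 1"] show False using dif(1) k0 by auto
  qed
  from diff_left[OF base V0] obtain i' where i': "i' \<le> p k0 - lw"
    "\<And>x. x \<in> {i'..<p k0} \<Longrightarrow> U x = U (x + d)" "U (i' - 1) \<noteq> U (i' - 1 + d)"
    "\<And>r. (U (i' - 1), U (i' - 1 + d)) \<in> r \<longleftrightarrow> (V (k0 - 1), V (k0 + c - 1)) \<in> ordA r" by metis
  from diff_right[OF p1 V1] obtain e' where e': "p k1 \<le> e'"
    "\<And>x. x \<in> {p k1..<e'} \<Longrightarrow> U x = U (x + d)" "U e' \<noteq> U (e' + d)"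
    "\<And>r. (U e', U (e' + d)) \<in> r \<longleftrightarrow> (V k1, V (k1 + c)) \<in> ordD r" by metis
  \<comment> \<open>Both are the first disagreement from \<open>p k1\<close> onwards; in the same
    way \<open>i - 1\<close> and \<open>i' - 1\<close> are the last one before
    \<open>p k0\<close>.\<close>
  have "e' = e"
  proof (cases e' e rule: linorder_cases)
    case less
    then have "e' \<in> {i..<e}" using e'(1) k0 pk01 by auto
    then show ?thesis using agree e'(3) by blast
  qed (use e'(2)[of e] k1 dif(2) in auto)
  moreover have "i' = i"
  proof (cases i' i rule: linorder_cases)
    case greater
    then have "i' - 1 \<in> {i..<e}" using i'(1) k0e by auto
    then show ?thesis using agree i'(3) by blast
  qed (use i'(2)[of "i - 1"] k0 dif(1) in auto)
  moreover have "(V (k0 - 1), V (k0 - 1 + c)) \<in> ordA rA \<longleftrightarrow> (V k1, V (k1 + c)) \<in> ordD rD"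
    using oc k01 V01 V0 V1 unfolding seq_order_condition_def
    by (metis diff_add_eq)
  ultimately show ?thesis using i'(4) e'(4) by (simp add: algebra_simps)
qed

text \<open>
  A factor with its two neighbouring letters, the factor itself avoiding \<open>w\<close>, fits into a
  complete return word.
\<close>

lemma factor_in_language:
  assumes L: "language A L" and ret: "\<And>a. a \<in> A' \<Longrightarrow> w @ \<psi> a \<in> L"
    and ie: "i \<le> e" and no: "\<And>k. \<not> (i + lw \<le> p k \<and> p k \<le> e)"
  shows "map U [i - 1..e] \<in> L"
proof -
  \<comment> \<open>Complete return word \<open>k\<close> begins with the last occurrence of
    \<open>w\<close> that starts before \<open>i\<close>; the next one starts at \<open>i\<close> or
    later, so by \<open>no\<close> its end position \<open>p (k + 1)\<close> exceeds
    \<open>e\<close>.\<close>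
  obtain k where k: "p k \<le> i + lw - 1" "i + lw - 1 < p (k + 1)" by (rule p_locate)
  have e: "e < p (k + 1)" using no[of "k + 1"] k(2) by linarith
  let ?b = "w @ \<psi> (V k)"
  define s where "s = nat (i - 1 - (p k - lw))"
  have s: "int s = i - 1 - (p k - lw)" using k by (simp add: s_def)
  have "map U [i - 1..e] = take (nat (e - i + 2)) (drop s ?b)"
  proof (rule nth_equalityI)
    show len: "length (map U [i - 1..e]) = length (take (nat (e - i + 2)) (drop s ?b))"
      using e s p_Suc[of k] ie by simp
    fix t assume "t < length (map U [i - 1..e])"
    then have t: "t < nat (e - i + 2)" by simp
    have "U (i - 1 + int t) = ?b ! (s + t)"
      using window[of "s + t" k] t s e p_Suc[of k] by (simp add: algebra_simps)
    moreover have "s \<le> length ?b" using s e ie p_Suc[of k] by simp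
    ultimately show "map U [i - 1..e] ! t = take (nat (e - i + 2)) (drop s ?b) ! t"
      using t by (simp add: nth_upto del: drop_append)
  qed
  then have "sublist (map U [i - 1..e]) ?b"
    by (metis sublist_drop sublist_take sublist_order.order_trans)
  then show ?thesis using L ret[OF V_in] unfolding language_def by blast
qed

text \<open>Either the common factor contains \<open>w\<close> and the condition comes from
  \<open>V\<close>, or both its occurrences with their neighbours belong to \<open>L\<close>; then
  it is bispecial and the condition comes from \<open>L\<close>.\<close>

lemma order_condition_lift:
  assumes L: "language A L" "order_condition rA rD L"
    and ret: "\<And>a. a \<in> A' \<Longrightarrow> w @ \<psi> a \<in> L"
    and oc: "seq_order_condition (ordA rA) (ordD rD) V"
  shows "seq_order_condition rA rD U"
  unfolding seq_order_condition_def
proof (intro allI impI; elim conjE)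
  fix i e d
  assume ie: "i \<le> e" and agree: "\<forall>x\<in>{i..<e}. U x = U (x + d)"
    and dif: "U (i - 1) \<noteq> U (i - 1 + d)" "U e \<noteq> U (e + d)"
  show "(U (i - 1), U (i - 1 + d)) \<in> rA \<longleftrightarrow> (U e, U (e + d)) \<in> rD"
  proof (cases "\<exists>k. i + lw \<le> p k \<and> p k \<le> e")
    case True
    then show ?thesis using order_condition_with_w[OF oc agree dif] by blast
  next
    case False
    \<comment> \<open>By agreement, an occurrence of \<open>w\<close> in the shifted copy would
      yield one in the factor itself.\<close>
    have "\<not> (i + d + lw \<le> p k \<and> p k \<le> e + d)" for k
    proof
      assume k: "i + d + lw \<le> p k \<and> p k \<le> e + d"
      have "U (p k - d - lw + int t) = w ! t" if "t < length w" for t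
      proof -
        have "p k - d - lw + int t \<in> {i..<e}" using that k by auto
        then have "U (p k - d - lw + int t) = U (p k - d - lw + int t + d)" using agree by blast
        then show ?thesis using w_before[OF that, of k] by (simp add: algebra_simps)
      qed
      then obtain k' where "p k' = p k - d" by (rule w_occurrence)
      then show False using False k by (auto dest: spec[of _ k'])
    qed
    then have in2: "map U [i + d - 1..e + d] \<in> L"
      using ie by (intro factor_in_language[OF L(1) ret]) auto
    have in1: "map U [i - 1..e] \<in> L"
      using False ie by (intro factor_in_language[OF L(1) ret]) auto
    define z where "z = map U [i..e - 1]"
    have z: "z = map U [i + d..e + d - 1]"
      unfolding z_def using agree ie by (intro nth_equalityI) (auto simp: nth_upto algebra_simps)
    have split: "[a - 1..b] = (a - 1) # [a..b - 1] @ [b]" if "a \<le> b" for a b :: int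
      using that upto_rec1[of "a - 1" b] upto_rec2[of a b] by simp
    have w1: "U (i - 1) # z @ [U e] \<in> L"
      using in1 split[OF ie] by (simp add: z_def)
    have "i + d \<le> e + d" using ie by simp
    from split[OF this] have w2: "U (i - 1 + d) # z @ [U (e + d)] \<in> L"
      using in2 by (simp add: z algebra_simps)
    have fac: "v \<in> L" if "sublist v u" "u \<in> L" for u v
      using L(1) that unfolding language_def by blast
    have sub: "sublist z (x # z @ [y])" "sublist (x # z) (x # z @ [y])"
        "sublist (z @ [y]) (x # z @ [y])" for x y
      using sublist_appendI[of z "[x]" "[y]"] sublist_appendI[of "x # z" "[]" "[y]"]
        sublist_appendI[of "z @ [y]" "[x]" "[]"] by simp_all
    have "bispecial L z"
      unfolding bispecial_def using fac[OF sub(1) w1] fac[OF sub(2) w1] fac[OF sub(2) w2]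
        fac[OF sub(3) w1] fac[OF sub(3) w2] dif by blast
    then show ?thesis
      using L(2) w1 w2 dif unfolding order_condition_def word_order_condition_def by blast
  qed
qed

end

section \<open>Periodic words\<close>

text \<open>The start of the image of letter \<open>k\<close> in the repetition of the image: whole
  periods, plus the preceding letters of the current one. Floor division makes this right for
  negative \<open>k\<close> too.\<close>

definition cut_point :: "('b \<Rightarrow> 'a list) \<Rightarrow> 'b list \<Rightarrow> int \<Rightarrow> int" where
  "cut_point f v k = (k div int (length v)) * int (length (concat (map f v))) +
     int (length (concat (map f (take (nat (k mod int (length v))) v))))"

lemma cut_point_Suc:
  assumes "v \<noteq> []"
  shows "cut_point f v (k + 1) = cut_point f v k + int (length (f (periodic v k)))"
proof -
  let ?n = "int (length v)"
  define q r where "q = k div ?n" and "r = nat (k mod ?n)"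
  have r: "r < length v" "int r = k mod ?n" using assms by (simp_all add: r_def nat_less_iff)
  have k: "k = q * ?n + int r" by (simp add: q_def r(2))
  have Suc: "length (concat (map f (take (Suc r) v))) =
      length (concat (map f (take r v))) + length (f (v ! r))"
    using r(1) by (simp add: take_Suc_conv_app_nth)
  have cutk: "cut_point f v k = q * int (length (concat (map f v))) + int (length (concat (map f (take r v))))"
    by (simp add: cut_point_def q_def r_def)
  have pk: "periodic v k = v ! r" by (simp add: periodic_def r_def)
  show ?thesis
  proof (cases "Suc r < length v")
    case True
    have k1: "k + 1 = q * ?n + int (Suc r)" using k by simp
    have "(k + 1) div ?n = q" "(k + 1) mod ?n = int (Suc r)"
      using k1 True by (auto intro: int_div_pos_eq int_mod_pos_eq simp del: of_nat_Suc simp: mult.commute)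
    then show ?thesis using Suc cutk pk by (simp add: cut_point_def del: of_nat_Suc)
  next
    case False
    then have n: "Suc r = length v" using r(1) by simp
    then have "?n = int r + 1" by simp
    then have k1: "k + 1 = (q + 1) * ?n" using k by (simp add: algebra_simps)
    have "(k + 1) div ?n = q + 1" "(k + 1) mod ?n = 0"
      unfolding k1 using assms by simp_all
    then show ?thesis using Suc n cutk pk by (simp add: cut_point_def algebra_simps)
  qed
qed

lemma periodic_cut_point:
  assumes "v \<noteq> []" "t < length (f (periodic v k))"
  shows "periodic (concat (map f v)) (cut_point f v k + int t) = f (periodic v k) ! t"
proof -
  define r where "r = nat (k mod int (length v))"
  define x where "x = concat (map f (take r v))"
  have r: "r < length v" using assms(1) by (simp add: r_def nat_less_iff)
  have pk: "periodic v k = v ! r" by (simp add: periodic_def r_def)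
  have "concat (map f v) = concat (map f (take r v @ v ! r # drop (Suc r) v))"
    using r by (simp only: id_take_nth_drop[symmetric])
  then have u: "concat (map f v) = x @ f (v ! r) @ concat (map f (drop (Suc r) v))"
    by (simp add: x_def)
  have "periodic (concat (map f v)) (cut_point f v k + int t) =
      periodic (concat (map f v)) (int (length x + t))"
    unfolding cut_point_def r_def[symmetric] x_def[symmetric] add.assoc periodic_add_mult by simp
  also have "\<dots> = concat (map f v) ! (length x + t)"
    using assms(2) by (intro periodic_nth) (simp add: u pk)
  also have "\<dots> = f (v ! r) ! t" using assms(2) by (simp add: u pk nth_append)
  finally show ?thesis by (simp add: pk)
qed

context return_words
begin

text \<open>The point is that \<open>w\<close> precedes every cut point. As \<open>w\<close> may be
  longer than a block, its letters are found by going back block by block, using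
  \<open>w @ \<psi> a = \<phi> a @ w\<close> each time.\<close>

lemma decomposed_sequence_suffix:
  assumes v: "v \<in> lists A'" "v \<noteq> []"
  shows "decomposed_sequence w A' \<phi> \<psi> (periodic (concat (map \<psi> v))) (periodic v) (cut_point \<psi> v)"
proof unfold_locales
  let ?U = "periodic (concat (map \<psi> v))" and ?V = "periodic v" and ?p = "cut_point \<psi> v"
  show V: "?V k \<in> A'" for k using periodic_in[OF v(2), of k] v(1) by auto
  show Suc: "?p (k + 1) = ?p k + int (length (\<psi> (?V k)))" for k by (rule cut_point_Suc[OF v(2)])
  have before: "?U (?p k - int t) = w ! (length w - t)" if "0 < t" "t \<le> length w" for k t
    using that
  proof (induction t arbitrary: k rule: less_induct)
    case (less t)
    let ?b = "\<psi> (?V (k - 1))"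
    have pk: "?p k = ?p (k - 1) + int (length ?b)" using Suc[of "k - 1"] by simp
    have len: "length (\<phi> (?V (k - 1))) = length ?b" by (rule length_eq[OF V])
    have step: "(w @ ?b) ! (length ?b + (length w - t)) = w ! (length w - t)"
      unfolding complete[OF V] using len by (simp add: nth_append)
    show ?case
    proof (cases "t \<le> length ?b")
      case True
      have shift: "?p k - int t = ?p (k - 1) + int (length ?b - t)" using pk True by simp
      have "?U (?p k - int t) = ?b ! (length ?b - t)"
        unfolding shift using True less.prems by (intro periodic_cut_point[OF v(2)]) simp
      also have "\<dots> = (w @ ?b) ! (length ?b + (length w - t))"
        using nth_append_length_plus[of w ?b "length ?b - t"] True less.prems
        by (simp add: add.commute)
      finally show ?thesis using step by simp
    next
      case False
      have shift: "?p k - int t = ?p (k - 1) - int (t - length ?b)" using pk False by simp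
      have "?U (?p k - int t) = w ! (length w - (t - length ?b))"
        unfolding shift using nonempty[OF V[of "k - 1"]] False less.prems by (intro less.IH) auto
      also have "length w - (t - length ?b) = length ?b + (length w - t)"
        using False less.prems by simp
      also have "w ! (length ?b + (length w - t)) = (w @ ?b) ! (length ?b + (length w - t))"
        using False less.prems by (subst nth_append) auto
      finally show ?thesis using step by simp
    qed
  qed
  show "?U (?p k - int (length w) + int t) = (w @ \<psi> (?V k)) ! t"
    if "t < length w + length (\<psi> (?V k))" for t k
  proof (cases "t < length w")
    case True
    have shift: "?p k - int (length w) + int t = ?p k - int (length w - t)" using True by simp
    show ?thesis unfolding shift using before[of "length w - t" k] True by (simp add: nth_append)
  next
    case False
    have shift: "?p k - int (length w) + int t = ?p k + int (t - length w)" using False by simp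
    show ?thesis unfolding shift using periodic_cut_point[OF v(2), of "t - length w" \<psi> k] False that
      by (simp add: nth_append)
  qed
qed

text \<open>Here \<open>w\<close> starts at every cut point, so the position after it is
  \<open>length w\<close> further on. Its letters are found by going forward block by block.\<close>

lemma decomposed_sequence_prefix:
  assumes v: "v \<in> lists A'" "v \<noteq> []"
  shows "decomposed_sequence w A' \<phi> \<psi> (periodic (concat (map \<phi> v))) (periodic v)
    (\<lambda>k. cut_point \<phi> v k + int (length w))"
proof unfold_locales
  let ?U = "periodic (concat (map \<phi> v))" and ?V = "periodic v" and ?p = "cut_point \<phi> v"
  show V: "?V k \<in> A'" for k using periodic_in[OF v(2), of k] v(1) by auto
  have Suc: "?p (k + 1) = ?p k + int (length (\<phi> (?V k)))" for k by (rule cut_point_Suc[OF v(2)])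
  then show "?p (k + 1) + int (length w) = ?p k + int (length w) + int (length (\<psi> (?V k)))" for k
    by (simp add: length_eq[OF V])
  have after: "?U (?p k + int t) = w ! t" if "t < length w" for k t
    using that
  proof (induction t arbitrary: k rule: less_induct)
    case (less t)
    let ?b = "\<phi> (?V k)"
    have step: "(?b @ w) ! t = w ! t"
      unfolding complete[OF V, symmetric] using less.prems by (simp add: nth_append)
    show ?case
    proof (cases "t < length ?b")
      case True
      then show ?thesis
        using periodic_cut_point[OF v(2), of t \<phi> k] step by (simp add: nth_append)
    next
      case False
      have "0 < length ?b" using nonempty[OF V[of k]] by (simp add: length_eq[OF V])
      moreover have shift: "?p k + int t = ?p (k + 1) + int (t - length ?b)"
        using Suc[of k] False by simp
      ultimately have "?U (?p k + int t) = w ! (t - length ?b)"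
        unfolding shift using False less.prems by (intro less.IH) linarith+
      then show ?thesis using step False by (simp add: nth_append)
    qed
  qed
  show "?U (?p k + int (length w) - int (length w) + int t) = (w @ \<psi> (?V k)) ! t"
    if t: "t < length w + length (\<psi> (?V k))" for t k
  proof (cases "t < length (\<phi> (?V k))")
    case True
    then show ?thesis
      using periodic_cut_point[OF v(2), of t \<phi> k] by (simp add: complete[OF V] nth_append)
  next
    case False
    have shift: "?p k + int (length w) - int (length w) + int t =
        ?p (k + 1) + int (t - length (\<phi> (?V k)))"
      using Suc[of k] False by simp
    have "t - length (\<phi> (?V k)) < length w" using t False by (simp add: length_eq[OF V])
    then show ?thesis
      unfolding shift using after[of "t - length (\<phi> (?V k))" "k + 1"] False
      by (simp add: complete[OF V] nth_append)
  qed
qed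

section \<open>Derived orders and transfer of clustering\<close>

lemma strict_linear_order_derived:
  assumes "strict_linear_order_on A r" "\<And>a. a \<in> A' \<Longrightarrow> w @ \<psi> a \<in> lists A"
  shows "strict_linear_order_on A' (ordA r)" "strict_linear_order_on A' (ordD r)"
proof -
  have "\<phi> a @ w \<in> lists A" if "a \<in> A'" for a using assms(2)[OF that] complete[OF that] by simp
  then have "rev (\<phi> a) \<in> lists A" if "a \<in> A'" for a using that by (fastforce simp: in_lists_conv_set)
  then show "strict_linear_order_on A' (ordA r)"
    unfolding ordA_def
    by (intro strict_linear_order_on_first_diff_less[OF assms(1)] parallel_rev_prefix_returns)
  have "\<psi> a \<in> lists A" if "a \<in> A'" for a using assms(2)[OF that] by auto
  then show "strict_linear_order_on A' (ordD r)"
    unfolding ordD_def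
    by (intro strict_linear_order_on_first_diff_less[OF assms(1)] parallel_suffix_returns)
qed

text \<open>For nonempty \<open>v\<close> both sides are order conditions on periodic words, and the
  decomposed sequence relates them in both directions.\<close>

lemma clusters_iff:
  assumes A: "finite A" "strict_linear_order_on A rA" "strict_linear_order_on A rD"
    and L: "language A L" "order_condition rA rD L"
    and ret: "\<And>a. a \<in> A' \<Longrightarrow> w @ \<psi> a \<in> L"
    and A': "finite A'" and v: "v \<in> lists A'" and f: "f = \<phi> \<or> f = \<psi>"
  shows "clusters A rA rD (concat (map f v)) \<longleftrightarrow> clusters A' (ordA rA) (ordD rD) v"
proof -
  have ret_A: "w @ \<psi> a \<in> lists A" if "a \<in> A'" for a
    using ret[OF that] L(1) unfolding language_def by blast
  then have "\<phi> a @ w \<in> lists A" if "a \<in> A'" for a using that by (metis complete)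
  then have f_in: "f a \<in> lists A" if "a \<in> A'" for a using f ret_A[OF that] that by auto
  have f_ne: "f a \<noteq> []" if "a \<in> A'" for a using f nonempty[OF that] length_eq[OF that] by auto
  have ord: "strict_linear_order_on A' (ordA rA)" "strict_linear_order_on A' (ordD rD)"
    using strict_linear_order_derived A(2,3) ret_A by blast+
  let ?u = "concat (map f v)"
  have u: "?u \<in> lists A" using v f_in by fastforce
  show ?thesis
  proof (cases "v = []")
    case True
    \<comment> \<open>The empty word has no periodic repetition; both transforms are empty and hence
      sorted.\<close>
    have "bwt rD [] = []" "bwt (ordD rD) [] = []"
      using A(3) ord(2) theI'[OF ex1_sorted_conjugates, of A rD "[]"]
        theI'[OF ex1_sorted_conjugates, of A' "ordD rD" "[]"]
      by (auto simp: bwt_def sorted_conjugates_def conjugates_def)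
    then show ?thesis
      using clusters_iff_sorted_bwt[OF A u] clusters_iff_sorted_bwt[OF A' ord v] True by simp
  next
    case False
    then have u_ne: "?u \<noteq> []" using v f_ne by (cases v) auto
    obtain p where "decomposed_sequence w A' \<phi> \<psi> (periodic ?u) (periodic v) p"
      using f decomposed_sequence_suffix[OF v False] decomposed_sequence_prefix[OF v False] by blast
    then interpret decomposed_sequence w A' \<phi> \<psi> "periodic ?u" "periodic v" p .
    show ?thesis
      unfolding clusters_iff_seq_order_condition[OF A u u_ne]
        clusters_iff_seq_order_condition[OF A' ord v False]
      using order_condition_derived order_condition_lift[OF L] ret by blast
  qed
qed

lemma derived_orders_and_clusters:
  assumes "finite A" "strict_linear_order_on A rA" "strict_linear_order_on A rD"
    and "language A L" "order_condition rA rD L" "\<And>a. a \<in> A' \<Longrightarrow> w @ \<psi> a \<in> L" "finite A'"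
    and f: "f = \<phi> \<or> f = \<psi>"
  shows "strict_linear_order_on A' (derived_A rA w A' f) \<and>
         strict_linear_order_on A' (derived_D rD w A' f) \<and>
         (\<forall>v \<in> lists A'.
            clusters A rA rD (concat (map f v)) \<longleftrightarrow>
            clusters A' (derived_A rA w A' f) (derived_D rD w A' f) v)"
proof -
  have ret_A: "w @ \<psi> a \<in> lists A" if "a \<in> A'" for a
    using assms(4,6) that unfolding language_def by blast
  have "derived_A rA w A' f = ordA rA" "derived_D rD w A' f = ordD rD"
    using f derived_orders_suffix derived_orders_prefix by auto
  then show ?thesis
    using strict_linear_order_derived(1)[OF assms(2)] strict_linear_order_derived(2)[OF assms(3)]
      ret_A clusters_iff[OF assms(1-7) _ f] by simp
qed

end

text \<open>The offsets \<open>0\<close> and \<open>length s\<close> are occurrences, and they are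
  distinct, since \<open>s = []\<close> would leave only one; being two, they are all of
  them.\<close>

lemma occurrences_complete_return_word:
  assumes card: "card (occurrences w u) = 2" and u: "u = w @ s" "u = t @ w"
  shows "s \<noteq> []" and "u = x @ w @ y \<Longrightarrow> x = [] \<or> y = []"
proof -
  have len: "length t = length s" using u by (metis add_left_imp_eq add.commute length_append)
  have occ: "length x \<in> occurrences w u" if "u = x @ w @ y" for x y
    using that by (simp add: occurrences_def)
  have in_occ: "0 \<in> occurrences w u" "length s \<in> occurrences w u"
    using occ[of "[]" s] occ[of t "[]"] u len by auto
  show s: "s \<noteq> []"
  proof
    assume "s = []"
    then have "occurrences w u \<subseteq> {0}" using u(1) by (auto simp: occurrences_def)
    then have "card (occurrences w u) \<le> 1" by (metis card_mono card_1_singleton_iff finite.emptyI finite_insert One_nat_def)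
    then show False using card by simp
  qed
  \<comment> \<open>\<open>card\<close> is 0 on infinite sets, so the value 2 gives
    finiteness.\<close>
  have "finite (occurrences w u)" using card by (simp add: card_ge_0_finite)
  then have "{0, length s} = occurrences w u"
    using in_occ s card by (intro card_subset_eq) auto
  then show "x = [] \<or> y = []" if "u = x @ w @ y"
    using occ[OF that] that u(1) by (metis add_cancel_right_right add.commute insertE length_0_conv length_append
        add_left_cancel singletonD)
qed

theorem theorem2:
  fixes A :: "'a set" and rA rD :: "('a \<times> 'a) set"
    and L :: "'a list set" and w :: "'a list"
    and A' :: "'b set" and \<phi> :: "'b \<Rightarrow> 'a list"
  assumes "finite A"
    and "strict_linear_order_on A rA" and "strict_linear_order_on A rD"
    and "language A L" and "order_condition rA rD L"
    and "w \<in> L"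
    and "finite A'" and "1 \<le> card A'" and "card A' \<le> card A"
    and "inj_on \<phi> A'"
    and "(\<forall>a\<in>A'. suffix_return_word L w (\<phi> a)) \<or> (\<forall>a\<in>A'. prefix_return_word L w (\<phi> a))"
  shows "strict_linear_order_on A' (derived_A rA w A' \<phi>) \<and>
         strict_linear_order_on A' (derived_D rD w A' \<phi>) \<and>
         (\<forall>v \<in> lists A'.
            clusters A rA rD (concat (map \<phi> v)) \<longleftrightarrow>
            clusters A' (derived_A rA w A' \<phi>) (derived_D rD w A' \<phi>) v)"
  using assms(11)
proof
  assume suf: "\<forall>a\<in>A'. suffix_return_word L w (\<phi> a)"
  then have "\<forall>a\<in>A'. \<exists>t. w @ \<phi> a = t @ w" by (auto simp: suffix_return_word_def suffix_def)
  then obtain \<theta> where \<theta>: "\<And>a. a \<in> A' \<Longrightarrow> w @ \<phi> a = \<theta> a @ w" by metis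
  have card: "card (occurrences w (w @ \<phi> a)) = 2" if "a \<in> A'" for a
    using suf that by (simp add: suffix_return_word_def)
  \<comment> \<open>The given words are suffix return words, so \<open>\<phi>\<close> takes the
    place of the locale's \<open>\<psi>\<close>, and \<open>\<theta>\<close> that of its
    \<open>\<phi>\<close>.\<close>
  interpret return_words w A' \<theta> \<phi>
    by unfold_locales (use occurrences_complete_return_word[OF card refl \<theta>] \<theta> assms(10) in auto)
  show ?thesis
    by (rule derived_orders_and_clusters[OF assms(1-5) _ assms(7)])
       (use suf in \<open>auto simp: suffix_return_word_def\<close>)
next
  assume pre: "\<forall>a\<in>A'. prefix_return_word L w (\<phi> a)"
  then have "\<forall>a\<in>A'. \<exists>s. \<phi> a @ w = w @ s" by (auto simp: prefix_return_word_def prefix_def)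
  then obtain \<theta> where \<theta>: "\<And>a. a \<in> A' \<Longrightarrow> \<phi> a @ w = w @ \<theta> a" by metis
  have card: "card (occurrences w (\<phi> a @ w)) = 2" if "a \<in> A'" for a
    using pre that by (simp add: prefix_return_word_def)
  \<comment> \<open>\<open>\<phi> a\<close> is recovered from \<open>\<theta> a\<close> by
    cancelling the final \<open>w\<close> in \<open>\<phi> a @ w = w @ \<theta> a\<close>.\<close>
  have "inj_on \<theta> A'"
    using assms(10) \<theta> unfolding inj_on_def by (metis append_same_eq)
  then interpret return_words w A' \<phi> \<theta>
    by unfold_locales (use occurrences_complete_return_word[OF card \<theta> refl] \<theta> in auto)
  show ?thesis
    by (rule derived_orders_and_clusters[OF assms(1-5) _ assms(7)])
       (use pre \<theta> in \<open>auto simp: prefix_return_word_def\<close>)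
qed

end
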